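(* Let $0<m<\infty$ and let $(M,g)$ be a smooth Riemannian manifold with Levi-Civita connection $\nabla$. Let $V$ be an $m$-modified conformal vector field on $(M,g)$, i.e. a smooth vector field satisfying $\frac12\mathcal{L}_V g-\frac1m v\otimes v=\sigma g$ for some smooth function $\sigma$ on $M$. If $V$ is also affine Killing, i.e. $\mathcal{L}_V\nabla=0$, then $V$ is trivial, that is, $V=0$ identically on $M$.
   Context: $\mathcal{L}_V$ denotes the Lie derivative along $V$ and $v=g(V,\cdot)$ is the $1$-form metrically associated to $V$. For $0<m<\infty$, a smooth vector field $V$ is called an $m$-modified conformal vector field if $\frac12\mathcal{L}_V g-\frac1m v\otimes v=\sigma g$ for some smooth function $\sigma$ on $M$; it is called trivial when $V=0$. The Lie derivative of the connection is the $(1,2)$-tensor $(\mathcal{L}_V\nabla)(X,Y)=[V,\nabla_X Y]-\nabla_{[V,X]}Y-\nabla_X[V,Y]$, and $V$ is affine Killing if this tensor vanishes (so that the local flow of $V$ preserves geodesics together with their affine parameters).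
   Formalization: The formal theorem assumes that M has dimension at least 2; in dimension 1 the statement fails, e.g. for V = d/dx on the real line with g = dx², where σ = -1/m and V is affine Killing but nonzero (dimension 0, where V = 0 trivially, is also left out). *)

theory Defs
  imports "HOL-Analysis.Analysis"
begin

text \<open>
  The manifold is the whole type \<open>'a\<close>; its smooth structure is given by an atlas of pairs
  (domain, coordinate map) with values in \<open>real ^ 'n\<close>, so the dimension is \<open>CARD('n)\<close>.
\<close>

text \<open>
  Intended for open \<open>S\<close>. A map is of class $C^{k+1}$ iff it is differentiable and all its
  directional derivatives are of class $C^k$.
\<close>

primrec Ck_on :: "nat \<Rightarrow> 'e::euclidean_space set \<Rightarrow> ('e \<Rightarrow> 'f::real_normed_vector) \<Rightarrow> bool" where
  "Ck_on 0 S f \<longleftrightarrow> continuous_on S f"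
| "Ck_on (Suc k) S f \<longleftrightarrow>
     (\<forall>x\<in>S. f differentiable (at x)) \<and> (\<forall>v. Ck_on k S (\<lambda>x. frechet_derivative f (at x) v))"

definition smooth_on :: "'e::euclidean_space set \<Rightarrow> ('e \<Rightarrow> 'f::real_normed_vector) \<Rightarrow> bool" where
  "smooth_on S f \<longleftrightarrow> (\<forall>k. Ck_on k S f)"

type_synonym ('a, 'n) atlas = "('a set \<times> ('a \<Rightarrow> real ^ 'n)) set"

definition smooth_atlas ::
    "('a::{t2_space, second_countable_topology}, 'n::finite) atlas \<Rightarrow> bool" where
  "smooth_atlas A \<longleftrightarrow>
     (\<forall>(U, \<phi>)\<in>A. open U \<and> open (\<phi> ` U) \<and> homeomorphism U (\<phi> ` U) \<phi> (inv_into U \<phi>)) \<and>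
     (\<Union>(U, \<phi>)\<in>A. U) = UNIV \<and>
     (\<forall>(U, \<phi>)\<in>A. \<forall>(W, \<psi>)\<in>A. smooth_on (\<phi> ` (U \<inter> W)) (\<psi> \<circ> inv_into U \<phi>))"

definition smooth_fun :: "('a, 'n::finite) atlas \<Rightarrow> ('a \<Rightarrow> real) \<Rightarrow> bool" where
  "smooth_fun A f \<longleftrightarrow> (\<forall>(U, \<phi>)\<in>A. smooth_on (\<phi> ` U) (f \<circ> inv_into U \<phi>))"

text \<open>
  A tangent vector at \<open>p\<close> is a derivation at \<open>p\<close> of the algebra of smooth functions. It is
  required to be \<open>0\<close> on non-smooth functions, so that equality of tangent vectors is equality in
  HOL.
\<close>

type_synonym 'a tvec = "('a \<Rightarrow> real) \<Rightarrow> real"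

definition tangent_space :: "('a, 'n::finite) atlas \<Rightarrow> 'a \<Rightarrow> 'a tvec set" where
  "tangent_space A p = {D.
     (\<forall>f h. smooth_fun A f \<longrightarrow> smooth_fun A h \<longrightarrow> D (\<lambda>q. f q + h q) = D f + D h) \<and>
     (\<forall>c f. smooth_fun A f \<longrightarrow> D (\<lambda>q. c * f q) = c * D f) \<and>
     (\<forall>f h. smooth_fun A f \<longrightarrow> smooth_fun A h \<longrightarrow> D (\<lambda>q. f q * h q) = f p * D h + h p * D f) \<and>
     (\<forall>f. \<not> smooth_fun A f \<longrightarrow> D f = 0)}"

text \<open>
  For a vector field \<open>X\<close> and a function \<open>f\<close>, the function $X f$ is \<open>\<lambda>p. X p f\<close>.
\<close>

type_synonym 'a vfield = "'a \<Rightarrow> 'a tvec"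

definition vector_field :: "('a, 'n::finite) atlas \<Rightarrow> 'a vfield \<Rightarrow> bool" where
  "vector_field A X \<longleftrightarrow>
     (\<forall>p. X p \<in> tangent_space A p) \<and>
     (\<forall>f. smooth_fun A f \<longrightarrow> smooth_fun A (\<lambda>p. X p f))"

text \<open>
  For vector fields \<open>X\<close> and \<open>Y\<close> this is \<open>0\<close> on non-smooth functions as well, because both
  inner functions are then identically \<open>0\<close>.
\<close>

definition lie_bracket :: "'a vfield \<Rightarrow> 'a vfield \<Rightarrow> 'a vfield" where
  "lie_bracket X Y = (\<lambda>p f. X p (\<lambda>q. Y q f) - Y p (\<lambda>q. X q f))"

type_synonym 'a metric_tensor = "'a \<Rightarrow> 'a tvec \<Rightarrow> 'a tvec \<Rightarrow> real"

definition riemannian_metric :: "('a, 'n::finite) atlas \<Rightarrow> 'a metric_tensor \<Rightarrow> bool" where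
  "riemannian_metric A g \<longleftrightarrow>
     (\<forall>p. \<forall>u\<in>tangent_space A p. \<forall>v\<in>tangent_space A p. \<forall>w\<in>tangent_space A p. \<forall>c.
        g p (\<lambda>f. c * u f + v f) w = c * g p u w + g p v w) \<and>
     (\<forall>p. \<forall>u\<in>tangent_space A p. \<forall>v\<in>tangent_space A p. g p u v = g p v u) \<and>
     (\<forall>p. \<forall>u\<in>tangent_space A p. u \<noteq> (\<lambda>f. 0) \<longrightarrow> g p u u > 0) \<and>
     (\<forall>X Y. vector_field A X \<longrightarrow> vector_field A Y \<longrightarrow> smooth_fun A (\<lambda>p. g p (X p) (Y p)))"

type_synonym 'a connection = "'a vfield \<Rightarrow> 'a vfield \<Rightarrow> 'a vfield"

definition affine_connection :: "('a, 'n::finite) atlas \<Rightarrow> 'a connection \<Rightarrow> bool" where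
  "affine_connection A N \<longleftrightarrow>
     (\<forall>X Y. vector_field A X \<longrightarrow> vector_field A Y \<longrightarrow> vector_field A (N X Y)) \<and>
     (\<forall>f X Z Y. smooth_fun A f \<longrightarrow> vector_field A X \<longrightarrow> vector_field A Z \<longrightarrow> vector_field A Y \<longrightarrow>
        N (\<lambda>p h. f p * X p h + Z p h) Y = (\<lambda>p h. f p * N X Y p h + N Z Y p h)) \<and>
     (\<forall>X Y Z. vector_field A X \<longrightarrow> vector_field A Y \<longrightarrow> vector_field A Z \<longrightarrow>
        N X (\<lambda>p h. Y p h + Z p h) = (\<lambda>p h. N X Y p h + N X Z p h)) \<and>
     (\<forall>f X Y. smooth_fun A f \<longrightarrow> vector_field A X \<longrightarrow> vector_field A Y \<longrightarrow>
        N X (\<lambda>p h. f p * Y p h) = (\<lambda>p h. X p f * Y p h + f p * N X Y p h))"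

definition levi_civita ::
    "('a, 'n::finite) atlas \<Rightarrow> 'a metric_tensor \<Rightarrow> 'a connection \<Rightarrow> bool" where
  "levi_civita A g N \<longleftrightarrow>
     affine_connection A N \<and>
     (\<forall>X Y. vector_field A X \<longrightarrow> vector_field A Y \<longrightarrow>
        (\<lambda>p h. N X Y p h - N Y X p h) = lie_bracket X Y) \<and>
     (\<forall>X Y Z p. vector_field A X \<longrightarrow> vector_field A Y \<longrightarrow> vector_field A Z \<longrightarrow>
        X p (\<lambda>q. g q (Y q) (Z q)) = g p (N X Y p) (Z p) + g p (Y p) (N X Z p))"

definition lie_deriv_metric ::
    "'a metric_tensor \<Rightarrow> 'a vfield \<Rightarrow> 'a vfield \<Rightarrow> 'a vfield \<Rightarrow> 'a \<Rightarrow> real" where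
  "lie_deriv_metric g V X Y p =
     V p (\<lambda>q. g q (X q) (Y q)) - g p (lie_bracket V X p) (Y p) - g p (X p) (lie_bracket V Y p)"

definition flat :: "'a metric_tensor \<Rightarrow> 'a vfield \<Rightarrow> 'a vfield \<Rightarrow> 'a \<Rightarrow> real" where
  "flat g V X p = g p (V p) (X p)"

definition m_modified_conformal ::
    "('a, 'n::finite) atlas \<Rightarrow> 'a metric_tensor \<Rightarrow> real \<Rightarrow> 'a vfield \<Rightarrow> bool" where
  "m_modified_conformal A g m V \<longleftrightarrow>
     vector_field A V \<and>
     (\<exists>\<sigma>. smooth_fun A \<sigma> \<and>
        (\<forall>X Y p. vector_field A X \<longrightarrow> vector_field A Y \<longrightarrow>
           1 / 2 * lie_deriv_metric g V X Y p - 1 / m * (flat g V X p * flat g V Y p)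
             = \<sigma> p * g p (X p) (Y p)))"

definition lie_deriv_connection ::
    "'a connection \<Rightarrow> 'a vfield \<Rightarrow> 'a vfield \<Rightarrow> 'a vfield \<Rightarrow> 'a vfield" where
  "lie_deriv_connection N V X Y =
     (\<lambda>p f. lie_bracket V (N X Y) p f - N (lie_bracket V X) Y p f - N X (lie_bracket V Y) p f)"

definition affine_killing :: "('a, 'n::finite) atlas \<Rightarrow> 'a connection \<Rightarrow> 'a vfield \<Rightarrow> bool" where
  "affine_killing A N V \<longleftrightarrow>
     vector_field A V \<and>
     (\<forall>X Y. vector_field A X \<longrightarrow> vector_field A Y \<longrightarrow>
        lie_deriv_connection N V X Y = (\<lambda>p f. 0))"

end

theory Submission
  imports Defs
begin

text \<open>
  Since \<open>V\<close> preserves the connection, $\mathcal{L}_V g$ is parallel. Hence so is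
  $\sigma g + \frac1m v \otimes v$, that is,
  $X(\sigma)\, g(Y,Z) + \frac1m (g(\nabla_X V, Y)\, v(Z) + v(Y)\, g(\nabla_X V, Z)) = 0$.
  Suppose $V_p \neq 0$ and take $Y_p \neq 0$ orthogonal to $V_p$, which exists in dimension at
  least 2. The choice $(Y,Y)$ gives $d\sigma = 0$ at \<open>p\<close>; then $(V,V)$ and $(V,Z)$ give $\nabla V = 0$
  at \<open>p\<close>, so $\mathcal{L}_V g = 0$ at \<open>p\<close>. The conformal equation on $(Y,Y)$ now yields
  $\sigma(p) = 0$, and on $(V,V)$ it yields $V_p = 0$.
  The argument is pointwise, but the hypotheses only concern globally defined fields, so \<open>Y\<close> is
  built from coordinate fields multiplied by a bump function.
\<close>

subsection \<open>Calculus of $C^k$ maps\<close>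

lemma Ck_on_SucD:
  assumes "Ck_on (Suc k) S f"
  shows "x \<in> S \<Longrightarrow> (f has_derivative frechet_derivative f (at x)) (at x)"
    and "Ck_on k S (\<lambda>x. frechet_derivative f (at x) v)"
  using assms by (auto simp: frechet_derivative_works)

text \<open>On an open \<open>S\<close>, agreement on \<open>S\<close> is agreement near each of its
  points. So the derivatives agree on \<open>S\<close> too, and the induction can pass to
  them.\<close>

lemma Ck_on_cong:
  assumes "open S" "Ck_on k S f" "\<And>x. x \<in> S \<Longrightarrow> f x = g x"
  shows "Ck_on k S g"
  using assms(2,3)
proof (induction k arbitrary: f g)
  case 0
  then show ?case by (simp cong: continuous_on_cong)
next
  case (Suc k)
  have g: "(g has_derivative frechet_derivative f (at x)) (at x)" if "x \<in> S" for x
    using has_derivative_transform_within_open[OF Ck_on_SucD(1)[OF Suc.prems(1) that] assms(1) that]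
      Suc.prems(2) by blast
  then have "frechet_derivative f (at x) = frechet_derivative g (at x)" if "x \<in> S" for x
    using frechet_derivative_at that by blast
  then have "Ck_on k S (\<lambda>x. frechet_derivative g (at x) v)" for v
    by (intro Suc.IH[OF Ck_on_SucD(2)[OF Suc.prems(1)]]) auto
  with g show ?case
    by (auto simp: differentiable_def)
qed

text \<open>By uniqueness of derivatives, \<open>frechet_derivative\<close> coincides on
  \<open>S\<close> with any explicit \<open>D\<close>. The closure rules below then only have to
  name a derivative and check its regularity.\<close>

lemma Ck_on_SucI:
  assumes "open S"
    and D: "\<And>x. x \<in> S \<Longrightarrow> (f has_derivative D x) (at x)"
    and Ck: "\<And>v. Ck_on k S (\<lambda>x. D x v)"
  shows "Ck_on (Suc k) S f"
proof -
  have "D x = frechet_derivative f (at x)" if "x \<in> S" for x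
    using D[OF that] frechet_derivative_at by blast
  then have "Ck_on k S (\<lambda>x. frechet_derivative f (at x) v)" for v
    by (intro Ck_on_cong[OF \<open>open S\<close> Ck]) auto
  with D show ?thesis
    by (auto simp: differentiable_def)
qed

lemma Ck_on_subset: "Ck_on k S f \<Longrightarrow> T \<subseteq> S \<Longrightarrow> Ck_on k T f"
  by (induction k arbitrary: f) (auto intro: continuous_on_subset)

text \<open>A neighbourhood that works for a map at order k+1 also works for its directional
  derivatives at order k, so the induction involves no gluing.\<close>

lemma Ck_on_local:
  assumes "\<And>x. x \<in> S \<Longrightarrow> \<exists>T. open T \<and> x \<in> T \<and> Ck_on k T f"
  shows "Ck_on k S f"
  using assms
proof (induction k arbitrary: f)
  case 0
  then show ?case
    by (metis Ck_on.simps(1) continuous_on_eq_continuous_at continuous_at_imp_continuous_on)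
next
  case (Suc k)
  show ?case
    unfolding Ck_on.simps
  proof (intro conjI ballI allI)
    show "f differentiable at x" if "x \<in> S" for x
      using Suc.prems[OF that] by auto
    show "Ck_on k S (\<lambda>x. frechet_derivative f (at x) v)" for v
      by (rule Suc.IH) (use Suc.prems in fastforce)
  qed
qed

lemma Ck_on_mono: "Ck_on (Suc k) S f \<Longrightarrow> Ck_on k S f"
proof (induction k arbitrary: f)
  case 0
  then show ?case
    by (auto intro!: continuous_at_imp_continuous_on differentiable_imp_continuous_within)
next
  case (Suc k)
  then show ?case by (metis Ck_on.simps(2))
qed

lemma Ck_on_const: "open S \<Longrightarrow> Ck_on k S (\<lambda>x. c)"
proof (induction k arbitrary: c)
  case (Suc k)
  show ?case
    by (rule Ck_on_SucI[where D = "\<lambda>_ _. 0"]) (use Suc in auto)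
qed simp

lemma Ck_on_linear:
  assumes "open S" "bounded_linear L"
  shows "Ck_on k S L"
proof (cases k)
  case 0
  then show ?thesis
    by (simp add: assms linear_continuous_on)
next
  case (Suc j)
  show ?thesis
    unfolding Suc
    by (rule Ck_on_SucI[where D = "\<lambda>_. L"])
      (use assms in \<open>auto intro: bounded_linear_imp_has_derivative Ck_on_const\<close>)
qed

lemma Ck_on_add:
  "open S \<Longrightarrow> Ck_on k S f \<Longrightarrow> Ck_on k S g \<Longrightarrow> Ck_on k S (\<lambda>x. f x + g x)"
proof (induction k arbitrary: f g)
  case (Suc k)
  show ?case
    by (rule Ck_on_SucI[where
          D = "\<lambda>x v. frechet_derivative f (at x) v + frechet_derivative g (at x) v"])
      (use Suc in \<open>auto intro!: has_derivative_add Ck_on_SucD simp del: Ck_on.simps\<close>)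
qed (auto intro: continuous_intros)

text \<open>The product rule contains \<open>f\<close> and \<open>g\<close> themselves besides their
  derivatives; \<open>Ck_on_mono\<close> lowers their order so that the induction hypothesis
  applies.\<close>

lemma Ck_on_scaleR:
  "open S \<Longrightarrow> Ck_on k S f \<Longrightarrow> Ck_on k S g \<Longrightarrow> Ck_on k S (\<lambda>x. f x *\<^sub>R g x)"
proof (induction k arbitrary: f g)
  case (Suc k)
  show ?case
  proof (rule Ck_on_SucI[OF Suc.prems(1)])
    show "((\<lambda>x. f x *\<^sub>R g x) has_derivative
        (\<lambda>v. f x *\<^sub>R frechet_derivative g (at x) v + frechet_derivative f (at x) v *\<^sub>R g x)) (at x)"
      if "x \<in> S" for x
      by (intro has_derivative_scaleR Ck_on_SucD(1)[OF Suc.prems(2)]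
          Ck_on_SucD(1)[OF Suc.prems(3)] that)
    show "Ck_on k S (\<lambda>x. f x *\<^sub>R frechet_derivative g (at x) v
        + frechet_derivative f (at x) v *\<^sub>R g x)" for v
      by (intro Ck_on_add Suc.IH Ck_on_SucD(2)[OF Suc.prems(2)] Ck_on_SucD(2)[OF Suc.prems(3)]
          Ck_on_mono[OF Suc.prems(2)] Ck_on_mono[OF Suc.prems(3)] Suc.prems(1))
  qed
qed (auto intro: continuous_intros)

lemma Ck_on_mult:
  fixes f g :: "_ \<Rightarrow> real"
  shows "open S \<Longrightarrow> Ck_on k S f \<Longrightarrow> Ck_on k S g \<Longrightarrow> Ck_on k S (\<lambda>x. f x * g x)"
  using Ck_on_scaleR[of S k f g] by simp

lemma Ck_on_sum:
  "open S \<Longrightarrow> (\<And>i. i \<in> I \<Longrightarrow> Ck_on k S (f i)) \<Longrightarrow> Ck_on k S (\<lambda>x. \<Sum>i\<in>I. f i x)"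
  by (induction I rule: infinite_finite_induct) (auto intro: Ck_on_const Ck_on_add)

lemma Ck_on_bounded_linear_comp:
  "open S \<Longrightarrow> bounded_linear L \<Longrightarrow> Ck_on k S f \<Longrightarrow> Ck_on k S (\<lambda>x. L (f x))"
proof (induction k arbitrary: f)
  case (Suc k)
  show ?case
    by (rule Ck_on_SucI[where D = "\<lambda>x v. L (frechet_derivative f (at x) v)"])
      (use Suc in \<open>auto intro!: bounded_linear.has_derivative[of L] Ck_on_SucD simp del: Ck_on.simps\<close>)
qed (auto intro: continuous_on_compose2 linear_continuous_on)

text \<open>In the chain rule the derivative of \<open>f\<close> is taken in the direction
  \<open>?Dg x v\<close>, which moves with \<open>x\<close>, whereas \<open>Ck_on\<close> controls
  fixed directions only. Expanding this direction in the basis leaves fixed directions with scalar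
  coefficients, and the sum and product rules apply.\<close>

lemma Ck_on_compose:
  fixes g :: "'e::euclidean_space \<Rightarrow> 'd::euclidean_space"
  shows "open S \<Longrightarrow> open T \<Longrightarrow> g ` S \<subseteq> T \<Longrightarrow> Ck_on k S g \<Longrightarrow> Ck_on k T f \<Longrightarrow>
    Ck_on k S (\<lambda>x. f (g x))"
proof (induction k arbitrary: f)
  case 0
  then show ?case by (auto intro: continuous_on_compose2)
next
  case (Suc k)
  let ?Df = "\<lambda>y. frechet_derivative f (at y)" and ?Dg = "\<lambda>x. frechet_derivative g (at x)"
  show ?case
  proof (rule Ck_on_SucI[OF Suc.prems(1)])
    fix x assume x: "x \<in> S"
    have f: "(f has_derivative ?Df (g x)) (at (g x))"
      using Ck_on_SucD(1)[OF Suc.prems(5)] x Suc.prems(3) by blast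
    have "?Df (g x) (?Dg x v) = (\<Sum>b\<in>Basis. (?Dg x v \<bullet> b) *\<^sub>R ?Df (g x) b)" for v
    proof -
      interpret linear "?Df (g x)"
        using f has_derivative_linear by blast
      have "?Df (g x) (?Dg x v) = ?Df (g x) (\<Sum>b\<in>Basis. (?Dg x v \<bullet> b) *\<^sub>R b)"
        by (simp add: euclidean_representation)
      then show ?thesis by (simp add: sum scale)
    qed
    then show "((\<lambda>x. f (g x)) has_derivative
        (\<lambda>v. \<Sum>b\<in>Basis. (?Dg x v \<bullet> b) *\<^sub>R ?Df (g x) b)) (at x)"
      using has_derivative_compose[OF Ck_on_SucD(1)[OF Suc.prems(4) x] f] by simp
  next
    show "Ck_on k S (\<lambda>x. \<Sum>b\<in>Basis. (?Dg x v \<bullet> b) *\<^sub>R ?Df (g x) b)" for v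
      by (intro Ck_on_sum Ck_on_scaleR Suc.prems Suc.IH Ck_on_mono[OF Suc.prems(4)]
          Ck_on_bounded_linear_comp[OF _ bounded_linear_inner_left]
          Ck_on_SucD(2)[OF Suc.prems(4)] Ck_on_SucD(2)[OF Suc.prems(5)])
  qed
qed

section \<open>Smooth maps\<close>

lemma smooth_on_SucD:
  assumes "smooth_on S f"
  shows "x \<in> S \<Longrightarrow> (f has_derivative frechet_derivative f (at x)) (at x)"
    and "smooth_on S (\<lambda>x. frechet_derivative f (at x) v)"
proof -
  have "Ck_on (Suc k) S f" for k
    using assms by (simp only: smooth_on_def)
  then show "x \<in> S \<Longrightarrow> (f has_derivative frechet_derivative f (at x)) (at x)"
    and "smooth_on S (\<lambda>x. frechet_derivative f (at x) v)"
    unfolding smooth_on_def by (metis Ck_on_SucD)+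
qed

lemma smooth_on_cong:
  "open S \<Longrightarrow> smooth_on S f \<Longrightarrow> (\<And>x. x \<in> S \<Longrightarrow> f x = g x) \<Longrightarrow> smooth_on S g"
  unfolding smooth_on_def using Ck_on_cong by blast

lemma smooth_on_subset: "smooth_on S f \<Longrightarrow> T \<subseteq> S \<Longrightarrow> smooth_on T f"
  unfolding smooth_on_def using Ck_on_subset by blast

lemma smooth_on_local:
  "(\<And>x. x \<in> S \<Longrightarrow> \<exists>T. open T \<and> x \<in> T \<and> smooth_on T f) \<Longrightarrow> smooth_on S f"
  unfolding smooth_on_def by (metis Ck_on_local)

lemma smooth_on_const: "open S \<Longrightarrow> smooth_on S (\<lambda>x. c)"
  by (simp add: smooth_on_def Ck_on_const)

lemma smooth_on_add:
  "open S \<Longrightarrow> smooth_on S f \<Longrightarrow> smooth_on S g \<Longrightarrow> smooth_on S (\<lambda>x. f x + g x)"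
  by (simp add: smooth_on_def Ck_on_add)

lemma smooth_on_mult:
  fixes f g :: "_ \<Rightarrow> real"
  shows "open S \<Longrightarrow> smooth_on S f \<Longrightarrow> smooth_on S g \<Longrightarrow> smooth_on S (\<lambda>x. f x * g x)"
  by (simp add: smooth_on_def Ck_on_mult)

lemma smooth_on_linear: "open S \<Longrightarrow> bounded_linear L \<Longrightarrow> smooth_on S L"
  by (simp add: smooth_on_def Ck_on_linear)

lemma smooth_on_compose:
  fixes g :: "'e::euclidean_space \<Rightarrow> 'd::euclidean_space"
  shows "open S \<Longrightarrow> open T \<Longrightarrow> g ` S \<subseteq> T \<Longrightarrow> smooth_on S g \<Longrightarrow> smooth_on T f \<Longrightarrow>
    smooth_on S (\<lambda>x. f (g x))"
  unfolding smooth_on_def using Ck_on_compose by blast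

subsection \<open>Bump functions\<close>

text \<open>
  The family is closed under differentiation up to linear combinations, so all its members are
  smooth by one induction.
\<close>

definition flat_exp :: "nat \<Rightarrow> real \<Rightarrow> real" where
  "flat_exp j t = (if t \<le> 0 then 0 else exp (- (1 / t)) / t ^ j)"

text \<open>From the right, the substitution s = 1/t turns the claim into s^j / exp s tending to 0
  at infinity.\<close>

lemma flat_exp_tendsto_0: "(flat_exp j \<longlongrightarrow> 0) (at 0)"
proof (rule filterlim_split_at)
  show "(flat_exp j \<longlongrightarrow> 0) (at_left 0)"
    by (rule tendsto_eventually) (auto simp: eventually_at_filter flat_exp_def)
  have "((\<lambda>t::real. inverse t ^ j / exp (inverse t)) \<longlongrightarrow> 0) (at_right 0)"
    by (rule filterlim_compose[OF tendsto_power_div_exp_0 filterlim_inverse_at_top_right])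
  moreover have "\<forall>\<^sub>F t in at_right 0. inverse t ^ j / exp (inverse t) = flat_exp j t"
    by (auto simp: eventually_at_filter flat_exp_def exp_minus field_simps)
  ultimately show "(flat_exp j \<longlongrightarrow> 0) (at_right 0)"
    by (rule Lim_transform_eventually)
qed

lemma flat_exp_has_derivative:
  "(flat_exp j has_field_derivative flat_exp (j + 2) t - real j * flat_exp (j + 1) t) (at t)"
proof -
  consider "t < 0" | "t = 0" | "t > 0" by linarith
  then show ?thesis
  proof cases
    case 1
    have "((\<lambda>_. 0) has_field_derivative 0) (at t)" by simp
    then have "(flat_exp j has_field_derivative 0) (at t)"
      by (rule has_field_derivative_transform_within_open[where S = "{..<0}"])
        (use 1 in \<open>auto simp: flat_exp_def\<close>)
    with 1 show ?thesis by (simp add: flat_exp_def)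
  next
    case 2
    \<comment> \<open>For h \<noteq> 0, the difference quotient of \<open>flat_exp j\<close> at 0 is
      again a member of the family, with exponent raised by one, so its limit is already
      known.\<close>
    have "\<forall>\<^sub>F h in at 0. flat_exp (Suc j) h = (flat_exp j (0 + h) - flat_exp j 0) / h"
      by (auto simp: eventually_at_filter flat_exp_def)
    then have "((\<lambda>h. (flat_exp j (0 + h) - flat_exp j 0) / h) \<longlongrightarrow> 0) (at 0)"
      by (rule Lim_transform_eventually[OF flat_exp_tendsto_0])
    then have "(flat_exp j has_field_derivative 0) (at 0)"
      by (simp add: DERIV_def)
    with 2 show ?thesis by (simp add: flat_exp_def)
  next
    case 3
    have "((\<lambda>s. exp (- (1 / s)) / s ^ j) has_field_derivative
        exp (- (1 / t)) / t ^ (j + 2) - real j * (exp (- (1 / t)) / t ^ (j + 1))) (at t)"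
    proof -
      let ?E = "exp (- (1 / t))"
      have "((\<lambda>s. exp (- (1 / s))) has_field_derivative ?E * (1 / t\<^sup>2)) (at t)"
        using 3 by (auto intro!: derivative_eq_intros simp: field_simps power2_eq_square)
      \<comment> \<open>Writing \<open>t ^ j / t\<close> instead of t^(j-1) avoids the truncated
        subtraction at j = 0.\<close>
      moreover have "((\<lambda>s. s ^ j) has_field_derivative real j * (t ^ j / t)) (at t)"
        using 3 DERIV_pow[of j t] by (cases j) auto
      ultimately have D: "((\<lambda>s. exp (- (1 / s)) / s ^ j) has_field_derivative
          (?E * (1 / t\<^sup>2) * t ^ j - ?E * (real j * (t ^ j / t))) / (t ^ j * t ^ j)) (at t)"
        using 3 by (intro DERIV_divide) auto
      have "(?E * (1 / t\<^sup>2) * T - ?E * (real j * (T / t))) / (T * T)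
          = ?E / (T * t\<^sup>2) - real j * (?E / (T * t))" if "T \<noteq> 0" for T
        using 3 that by (simp add: field_simps power2_eq_square)
      from this[of "t ^ j"] D show ?thesis
        using 3 by (simp add: power2_eq_square mult_ac)
    qed
    then have "(flat_exp j has_field_derivative
        exp (- (1 / t)) / t ^ (j + 2) - real j * (exp (- (1 / t)) / t ^ (j + 1))) (at t)"
      by (rule has_field_derivative_transform_within_open[where S = "{0<..}"])
        (use 3 in \<open>auto simp: flat_exp_def\<close>)
    with 3 show ?thesis by (simp add: flat_exp_def)
  qed
qed

lemma Ck_on_flat_exp: "Ck_on k UNIV (flat_exp j)"
proof (induction k arbitrary: j)
  case 0
  show ?case
    using flat_exp_has_derivative
    by (auto intro!: continuous_at_imp_continuous_on DERIV_isCont)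
next
  case (Suc k)
  show ?case
  proof (rule Ck_on_SucI)
    show "(flat_exp j has_derivative
        (\<lambda>v. (flat_exp (j + 2) t + (- real j) * flat_exp (j + 1) t) * v)) (at t)" for t
      using flat_exp_has_derivative[of j t] by (simp add: has_field_derivative_def)
    show "Ck_on k UNIV (\<lambda>t. (flat_exp (j + 2) t + (- real j) * flat_exp (j + 1) t) * v)" for v
      by (intro Ck_on_add Ck_on_mult Ck_on_const Suc.IH open_UNIV)
  qed auto
qed

text \<open>The squared distance is a polynomial in the coordinates, hence smooth at
  \<open>a\<close> as well. The argument of \<open>flat_exp 0\<close> is positive exactly inside the
  ball when r > 0.\<close>

definition bump :: "'e::euclidean_space \<Rightarrow> real \<Rightarrow> 'e \<Rightarrow> real" where
  "bump a r x = flat_exp 0 (r\<^sup>2 - (dist x a)\<^sup>2)"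

lemma bump_center: "r > 0 \<Longrightarrow> bump a r a > 0"
  by (simp add: bump_def flat_exp_def)

lemma bump_outside: "r > 0 \<Longrightarrow> x \<notin> cball a r \<Longrightarrow> bump a r x = 0"
  by (auto simp: bump_def flat_exp_def dist_commute power_mono)

lemma smooth_on_bump: "smooth_on UNIV (bump a r)"
  unfolding smooth_on_def
proof
  fix k
  \<comment> \<open>The squared distance is spelled out with sums and products only, to match the
    closure rules.\<close>
  have "Ck_on k UNIV (\<lambda>x. flat_exp 0 (r\<^sup>2 + (-1) *
      (\<Sum>b\<in>Basis. (x \<bullet> b + (- (a \<bullet> b))) * (x \<bullet> b + (- (a \<bullet> b))))))"
    by (rule Ck_on_compose[OF _ _ _ _ Ck_on_flat_exp])
      (intro Ck_on_add Ck_on_mult Ck_on_sum Ck_on_const open_UNIV subset_UNIV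
        Ck_on_linear[OF _ bounded_linear_inner_left])+
  moreover have "(\<Sum>b\<in>Basis. (x \<bullet> b + (- (a \<bullet> b))) * (x \<bullet> b + (- (a \<bullet> b)))) = (dist x a)\<^sup>2" for x
    unfolding dist_norm power2_norm_eq_inner euclidean_inner[of "x - a" "x - a"]
    by (simp add: inner_diff_left)
  ultimately show "Ck_on k UNIV (bump a r)"
    by (simp add: bump_def[abs_def])
qed

subsection \<open>Functions and vector fields supported in a chart\<close>

lemma smooth_atlas_chartD:
  assumes "smooth_atlas A" "(U, \<phi>) \<in> A"
  shows "open U" "open (\<phi> ` U)" "homeomorphism U (\<phi> ` U) \<phi> (inv_into U \<phi>)"
  using assms unfolding smooth_atlas_def by (auto dest!: bspec[of A _ "(U, \<phi>)"])

lemma smooth_atlas_inj_on: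
  assumes "smooth_atlas A" "(U, \<phi>) \<in> A"
  shows "inj_on \<phi> U"
  by (rule inj_on_inverseI[of _ "inv_into U \<phi>"])
    (use smooth_atlas_chartD(3)[OF assms] in \<open>simp add: homeomorphism_def\<close>)

lemma smooth_atlas_transition:
  assumes "smooth_atlas A" "(U, \<phi>) \<in> A" "(W, \<psi>) \<in> A"
  shows "smooth_on (\<phi> ` (U \<inter> W)) (\<psi> \<circ> inv_into U \<phi>)"
proof -
  have "\<forall>(U, \<phi>)\<in>A. \<forall>(W, \<psi>)\<in>A. smooth_on (\<phi> ` (U \<inter> W)) (\<psi> \<circ> inv_into U \<phi>)"
    using assms(1) by (simp add: smooth_atlas_def)
  from bspec[OF bspec[OF this assms(2), unfolded prod.case] assms(3)] show ?thesis by simp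
qed

lemma smooth_atlas_cover:
  assumes "smooth_atlas A"
  obtains U \<phi> where "(U, \<phi>) \<in> A" "p \<in> U"
proof -
  have "p \<in> (\<Union>(U, \<phi>)\<in>A. U)"
    using assms by (simp add: smooth_atlas_def)
  then show ?thesis using that by auto
qed

lemma smooth_atlas_open_image:
  assumes "smooth_atlas A" "(U, \<phi>) \<in> A" "open T" "T \<subseteq> U"
  shows "open (\<phi> ` T)"
proof -
  have "openin (top_of_set (\<phi> ` U)) (\<phi> ` T)"
    by (rule homeomorphism_imp_open_map[OF smooth_atlas_chartD(3)[OF assms(1,2)]])
      (simp add: openin_open_eq smooth_atlas_chartD(1)[OF assms(1,2)] assms(3,4))
  then show ?thesis
    by (simp add: openin_open_eq smooth_atlas_chartD(2)[OF assms(1,2)])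
qed

section \<open>Smooth functions on the manifold and extension by zero\<close>

lemma smooth_funD: "smooth_fun A f \<Longrightarrow> (U, \<phi>) \<in> A \<Longrightarrow> smooth_on (\<phi> ` U) (f \<circ> inv_into U \<phi>)"
  by (auto simp: smooth_fun_def)

lemma smooth_funI:
  "(\<And>U \<phi>. (U, \<phi>) \<in> A \<Longrightarrow> smooth_on (\<phi> ` U) (\<lambda>x. f (inv_into U \<phi> x))) \<Longrightarrow> smooth_fun A f"
  by (auto simp: smooth_fun_def comp_def)

lemma smooth_fun_const: "smooth_atlas A \<Longrightarrow> smooth_fun A (\<lambda>p. c)"
  by (intro smooth_funI smooth_on_const smooth_atlas_chartD(2))

lemma smooth_fun_add:
  "smooth_atlas A \<Longrightarrow> smooth_fun A f \<Longrightarrow> smooth_fun A h \<Longrightarrow> smooth_fun A (\<lambda>p. f p + h p)"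
  by (intro smooth_funI smooth_on_add) (auto dest: smooth_funD simp: smooth_atlas_chartD(2) comp_def)

lemma smooth_fun_mult:
  "smooth_atlas A \<Longrightarrow> smooth_fun A f \<Longrightarrow> smooth_fun A h \<Longrightarrow> smooth_fun A (\<lambda>p. f p * h p)"
  by (intro smooth_funI smooth_on_mult) (auto dest: smooth_funD simp: smooth_atlas_chartD(2) comp_def)

lemma smooth_fun_cmult:
  "smooth_atlas A \<Longrightarrow> smooth_fun A f \<Longrightarrow> smooth_fun A (\<lambda>p. c * f p)"
  by (rule smooth_fun_mult[OF _ smooth_fun_const])

lemma smooth_fun_diff:
  "smooth_atlas A \<Longrightarrow> smooth_fun A f \<Longrightarrow> smooth_fun A h \<Longrightarrow> smooth_fun A (\<lambda>p. f p - h p)"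
  using smooth_fun_add[of A f "\<lambda>p. -1 * h p"] smooth_fun_cmult[of A h "-1"] by simp

definition extend_chart :: "'a set \<Rightarrow> ('a \<Rightarrow> 'e) \<Rightarrow> ('e \<Rightarrow> real) \<Rightarrow> 'a \<Rightarrow> real" where
  "extend_chart U \<phi> F p = (if p \<in> U then F (\<phi> p) else 0)"

lemma extend_chart_comp_inv:
  "x \<in> \<phi> ` U \<Longrightarrow> (extend_chart U \<phi> F \<circ> inv_into U \<phi>) x = F x"
  by (simp add: extend_chart_def inv_into_into f_inv_into_f)

text \<open>Smoothness is checked near each point of an arbitrary chart \<open>W\<close>. At a point
  of \<open>U\<close> the extension is \<open>F\<close> composed with a transition map. At a point
  outside \<open>U\<close> it vanishes nearby, because its support lies in \<open>?L\<close>, the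
  preimage of \<open>K\<close>: this set is compact, hence closed in the Hausdorff space, and
  contained in \<open>U\<close>.\<close>

lemma smooth_fun_extend_chart:
  fixes A :: "('a::{t2_space, second_countable_topology}, 'n::finite) atlas"
  assumes A: "smooth_atlas A" and U: "(U, \<phi>) \<in> A" and F: "smooth_on (\<phi> ` U) F"
    and K: "compact K" "K \<subseteq> \<phi> ` U" and F0: "\<And>x. x \<notin> K \<Longrightarrow> F x = 0"
  shows "smooth_fun A (extend_chart U \<phi> F)"
proof (rule smooth_funI)
  fix W \<psi> assume W: "(W, \<psi>) \<in> A"
  let ?f = "extend_chart U \<phi> F" and ?L = "inv_into U \<phi> ` K"
  have "continuous_on K (inv_into U \<phi>)"
    using smooth_atlas_chartD(3)[OF A U] K(2) by (meson homeomorphism_def continuous_on_subset)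
  then have "closed ?L"
    using K(1) by (intro compact_imp_closed compact_continuous_image)
  have f0: "?f q = 0" if "q \<notin> ?L" for q
  proof (cases "q \<in> U")
    case True
    then have "\<phi> q \<notin> K"
      using that inv_into_f_f[OF smooth_atlas_inj_on[OF A U] True] by (metis imageI)
    then show ?thesis by (simp add: F0 extend_chart_def)
  qed (simp add: extend_chart_def)
  have "smooth_on (\<psi> ` W) (?f \<circ> inv_into W \<psi>)"
  proof (rule smooth_on_local)
    fix x assume "x \<in> \<psi> ` W"
    then obtain q where q: "q \<in> W" "x = \<psi> q" by blast
    have inv: "inv_into W \<psi> (\<psi> r) = r" if "r \<in> W" for r
      using that smooth_atlas_inj_on[OF A W] by simp
    show "\<exists>T. open T \<and> x \<in> T \<and> smooth_on T (?f \<circ> inv_into W \<psi>)"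
    proof (cases "q \<in> U")
      case True
      let ?T = "\<psi> ` (W \<inter> U)"
      have T: "open ?T"
        by (intro smooth_atlas_open_image[OF A W] open_Int smooth_atlas_chartD(1)[OF A W]
            smooth_atlas_chartD(1)[OF A U] Int_lower1)
      have "smooth_on ?T (\<lambda>x. F ((\<phi> \<circ> inv_into W \<psi>) x))"
        by (rule smooth_on_compose[OF T _ _ smooth_atlas_transition[OF A W U] F])
          (use smooth_atlas_chartD(2)[OF A U] in \<open>auto simp: inv\<close>)
      then have "smooth_on ?T (?f \<circ> inv_into W \<psi>)"
        by (rule smooth_on_cong[OF T]) (auto simp: inv extend_chart_def)
      moreover have "x \<in> ?T" using q True by simp
      ultimately show ?thesis using T by (intro exI[of _ ?T]) simp
    next
      case False
      let ?T = "\<psi> ` (W - ?L)"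
      have T: "open ?T"
        by (intro smooth_atlas_open_image[OF A W] open_Diff smooth_atlas_chartD(1)[OF A W]
            \<open>closed ?L\<close> Diff_subset)
      have "smooth_on ?T (?f \<circ> inv_into W \<psi>)"
        by (rule smooth_on_cong[OF T smooth_on_const[OF T, of 0]]) (auto simp: inv f0)
      moreover have "x \<in> ?T"
        using q False K(2) inv_into_into[of _ \<phi> U] by blast
      ultimately show ?thesis using T by (intro exI[of _ ?T]) simp
    qed
  qed
  then show "smooth_on (\<psi> ` W) (\<lambda>x. ?f (inv_into W \<psi> x))"
    by (simp add: comp_def)
qed

text \<open>This is \<beta> times the coordinate derivation in direction \<open>b\<close>, extended
  by zero outside the chart. The case distinction gives the value 0 on non-smooth functions that
  \<open>tangent_space\<close> demands.\<close>

definition coord_field ::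
    "('a, 'n::finite) atlas \<Rightarrow> 'a set \<Rightarrow> ('a \<Rightarrow> real ^ 'n) \<Rightarrow> (real ^ 'n \<Rightarrow> real) \<Rightarrow> real ^ 'n \<Rightarrow> 'a vfield" where
  "coord_field A U \<phi> \<beta> b p f =
    (if smooth_fun A f
     then extend_chart U \<phi> (\<lambda>x. \<beta> x * frechet_derivative (f \<circ> inv_into U \<phi>) (at x) b) p else 0)"

lemma smooth_fun_has_derivative:
  assumes "smooth_fun A f" "(U, \<phi>) \<in> A" "x \<in> \<phi> ` U"
  shows "((f \<circ> inv_into U \<phi>) has_derivative frechet_derivative (f \<circ> inv_into U \<phi>) (at x)) (at x)"
  using smooth_on_SucD(1)[OF smooth_funD[OF assms(1,2)] assms(3)] .

lemma coord_field_eq: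
  assumes "smooth_fun A f" "q \<in> U" "((f \<circ> inv_into U \<phi>) has_derivative f') (at (\<phi> q))"
  shows "coord_field A U \<phi> \<beta> b q f = \<beta> (\<phi> q) * f' b"
  using assms frechet_derivative_at[OF assms(3)] by (simp add: coord_field_def extend_chart_def)

lemma vector_field_coord_field:
  fixes A :: "('a::{t2_space, second_countable_topology}, 'n::finite) atlas"
  assumes A: "smooth_atlas A" and U: "(U, \<phi>) \<in> A" and \<beta>: "smooth_on (\<phi> ` U) \<beta>"
    and K: "compact K" "K \<subseteq> \<phi> ` U" and \<beta>0: "\<And>x. x \<notin> K \<Longrightarrow> \<beta> x = 0"
  shows "vector_field A (coord_field A U \<phi> \<beta> b)"
  unfolding vector_field_def
proof (intro conjI allI impI)
  fix f assume f: "smooth_fun A f"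
  have "smooth_fun A (extend_chart U \<phi> (\<lambda>x. \<beta> x * frechet_derivative (f \<circ> inv_into U \<phi>) (at x) b))"
    by (rule smooth_fun_extend_chart[OF A U _ K])
      (simp_all add: \<beta>0 smooth_on_mult smooth_atlas_chartD(2)[OF A U] \<beta>
        smooth_on_SucD(2)[OF smooth_funD[OF f U]])
  then show "smooth_fun A (\<lambda>p. coord_field A U \<phi> \<beta> b p f)"
    using f by (simp add: coord_field_def)
next
  fix p
  let ?X = "coord_field A U \<phi> \<beta> b p"
  let ?D = "\<lambda>f. frechet_derivative (f \<circ> inv_into U \<phi>) (at (\<phi> p))"
  show "?X \<in> tangent_space A p"
  proof (cases "p \<in> U")
    case False
    then show ?thesis by (simp add: tangent_space_def coord_field_def extend_chart_def)
  next
    case True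
    then have x: "\<phi> p \<in> \<phi> ` U" and inv: "inv_into U \<phi> (\<phi> p) = p"
      using smooth_atlas_inj_on[OF A U] by auto
    note D = smooth_fun_has_derivative[OF _ U x, unfolded comp_def]
    note eq = coord_field_eq[OF _ True, unfolded comp_def]
    show ?thesis
      unfolding tangent_space_def mem_Collect_eq
    proof (intro conjI allI impI)
      fix f h assume f: "smooth_fun A f" and h: "smooth_fun A h"
      show "?X (\<lambda>q. f q + h q) = ?X f + ?X h"
        by (simp add: eq[OF smooth_fun_add[OF A f h] has_derivative_add[OF D[OF f] D[OF h]]]
            eq[OF f D[OF f]] eq[OF h D[OF h]] algebra_simps)
      show "?X (\<lambda>q. f q * h q) = f p * ?X h + h p * ?X f"
        by (simp add: eq[OF smooth_fun_mult[OF A f h] has_derivative_mult[OF D[OF f] D[OF h]]]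
            eq[OF f D[OF f]] eq[OF h D[OF h]] inv algebra_simps)
    next
      fix c f assume f: "smooth_fun A f"
      show "?X (\<lambda>q. c * f q) = c * ?X f"
        by (simp add: eq[OF smooth_fun_cmult[OF A f] has_derivative_mult_right[OF D[OF f]]]
            eq[OF f D[OF f]])
    qed (simp add: coord_field_def)
  qed
qed

text \<open>Two cut-off coordinate fields with different indices are linearly independent at
  \<open>p\<close>, as the cut-off coordinate functions detect. Hence they cannot both be multiples
  of the same \<open>u\<close>.\<close>

lemma exists_vector_field_not_multiple:
  fixes A :: "('a::{t2_space, second_countable_topology}, 'n::finite) atlas"
    and u :: "'a tvec"
  assumes A: "smooth_atlas A" and n: "2 \<le> CARD('n)"
  shows "\<exists>W. vector_field A W \<and> (\<forall>c. W p \<noteq> (\<lambda>f. c * u f))"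
proof -
  obtain U \<phi> where U: "(U, \<phi>) \<in> A" and p: "p \<in> U"
    using smooth_atlas_cover[OF A] .
  note op = smooth_atlas_chartD(2)[OF A U]
  obtain r where r: "r > 0" "cball (\<phi> p) r \<subseteq> \<phi> ` U"
    using op p open_contains_cball by blast
  let ?\<beta> = "bump (\<phi> p) r"
  have \<beta>: "smooth_on (\<phi> ` U) ?\<beta>"
    using smooth_on_subset[OF smooth_on_bump] by blast
  note \<beta>0 = bump_outside[OF r(1), of _ "\<phi> p"]
  define X where "X i = coord_field A U \<phi> ?\<beta> (axis i 1)" for i
  \<comment> \<open>The coordinates, centred at \<open>p\<close>, also need a cut-off, since tangent
    vectors act on globally smooth functions only. The two cut-offs produce the square of
    \<open>?\<beta> (\<phi> p)\<close> below.\<close>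
  define F where "F i = (\<lambda>x. ?\<beta> x * ((x - \<phi> p) $ i))" for i
  define f where "f i = extend_chart U \<phi> (F i)" for i
  have X: "vector_field A (X i)" for i
    unfolding X_def by (rule vector_field_coord_field[OF A U \<beta> compact_cball r(2) \<beta>0])
  have "smooth_on (\<phi> ` U) (\<lambda>x. (x - \<phi> p) $ i)" for i
    using smooth_on_add[OF op smooth_on_linear[OF op bounded_linear_vec_nth[of i]]
        smooth_on_const[OF op, of "- (\<phi> p $ i)"]] by simp
  then have f: "smooth_fun A (f i)" for i
    unfolding f_def F_def
    by (intro smooth_fun_extend_chart[OF A U _ compact_cball r(2)] smooth_on_mult op \<beta>)
      (simp_all add: \<beta>0)
  have Xf: "X i p (f j) = (if i = j then (?\<beta> (\<phi> p))\<^sup>2 else 0)" for i j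
  proof -
    have "(?\<beta> has_derivative frechet_derivative ?\<beta> (at (\<phi> p))) (at (\<phi> p))"
      using smooth_on_SucD(1)[OF smooth_on_bump] by blast
    \<comment> \<open>The product-rule term with the derivative of \<open>?\<beta>\<close> drops
      out, because its other factor vanishes at \<open>\<phi> p\<close>.\<close>
    then have "(F j has_derivative (\<lambda>v. ?\<beta> (\<phi> p) * (v $ j))) (at (\<phi> p))"
      unfolding F_def
      by (auto intro!: derivative_eq_intros bounded_linear.has_derivative[OF bounded_linear_vec_nth])
    then have "((f j \<circ> inv_into U \<phi>) has_derivative (\<lambda>v. ?\<beta> (\<phi> p) * (v $ j))) (at (\<phi> p))"
      by (rule has_derivative_transform_within_open[OF _ op])
        (use p in \<open>auto simp only: f_def extend_chart_comp_inv\<close>)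
    from coord_field_eq[OF f p this] show ?thesis
      by (simp add: X_def axis_def power2_eq_square)
  qed
  have \<beta>p: "?\<beta> (\<phi> p) \<noteq> 0"
    using bump_center[OF r(1), of "\<phi> p"] by simp
  obtain i j :: 'n where ij: "i \<noteq> j"
    using n by (metis (full_types) UNIV_I card_2_iff' card_le_Suc0_iff_eq finite not_less_eq_eq numeral_2_eq_2)
  have "(\<forall>c. X i p \<noteq> (\<lambda>f. c * u f)) \<or> (\<forall>c. X j p \<noteq> (\<lambda>f. c * u f))"
  proof (rule ccontr)
    assume "\<not> ?thesis"
    then obtain c d where c: "X i p = (\<lambda>f. c * u f)" and d: "X j p = (\<lambda>f. d * u f)" by auto
    \<comment> \<open>The second fact gives c \<noteq> 0, so the first forces
      \<open>u (f j) = 0\<close>, against the third.\<close>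
    have "c * u (f j) = 0" "c * u (f i) \<noteq> 0" "d * u (f j) \<noteq> 0"
      using Xf[of i j] Xf[of i i] Xf[of j j] ij \<beta>p by (simp_all add: c d)
    then show False by auto
  qed
  with X show ?thesis by blast
qed

subsection \<open>Tangent vectors and Lie brackets\<close>

lemma smooth_fun_vector_field:
  "vector_field A X \<Longrightarrow> smooth_fun A f \<Longrightarrow> smooth_fun A (\<lambda>p. X p f)"
  by (simp add: vector_field_def)

lemma vector_field_tangent: "vector_field A X \<Longrightarrow> X p \<in> tangent_space A p"
  by (simp add: vector_field_def)

lemma tangent_spaceD:
  assumes "D \<in> tangent_space A p"
  shows "smooth_fun A f \<Longrightarrow> smooth_fun A h \<Longrightarrow> D (\<lambda>q. f q + h q) = D f + D h"
    and "smooth_fun A f \<Longrightarrow> D (\<lambda>q. c * f q) = c * D f"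
    and "smooth_fun A f \<Longrightarrow> smooth_fun A h \<Longrightarrow> D (\<lambda>q. f q * h q) = f p * D h + h p * D f"
    and "\<not> smooth_fun A f \<Longrightarrow> D f = 0"
  using assms unfolding tangent_space_def mem_Collect_eq by blast+

lemma tangent_space_diff:
  assumes "smooth_atlas A" "D \<in> tangent_space A p" "smooth_fun A f" "smooth_fun A h"
  shows "D (\<lambda>q. f q - h q) = D f - D h"
  using tangent_spaceD(1)[OF assms(2,3) smooth_fun_cmult[OF assms(1,4), of "-1"]]
    tangent_spaceD(2)[OF assms(2,4), of "-1"] by simp

lemma tangent_space_lincomb:
  assumes u: "u \<in> tangent_space A p" and v: "v \<in> tangent_space A p"
  shows "(\<lambda>f. c * u f + v f) \<in> tangent_space A p"
  unfolding tangent_space_def mem_Collect_eq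
proof (intro conjI allI impI)
  fix f h assume f: "smooth_fun A f" and h: "smooth_fun A h"
  show "c * u (\<lambda>q. f q + h q) + v (\<lambda>q. f q + h q) = c * u f + v f + (c * u h + v h)"
    unfolding tangent_spaceD(1)[OF u f h] tangent_spaceD(1)[OF v f h] by (simp add: algebra_simps)
  show "c * u (\<lambda>q. f q * h q) + v (\<lambda>q. f q * h q)
      = f p * (c * u h + v h) + h p * (c * u f + v f)"
    unfolding tangent_spaceD(3)[OF u f h] tangent_spaceD(3)[OF v f h] by (simp add: algebra_simps)
next
  fix d f assume f: "smooth_fun A f"
  show "c * u (\<lambda>q. d * f q) + v (\<lambda>q. d * f q) = d * (c * u f + v f)"
    unfolding tangent_spaceD(2)[OF u f] tangent_spaceD(2)[OF v f] by (simp add: algebra_simps)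
qed (simp add: tangent_spaceD(4)[OF u] tangent_spaceD(4)[OF v])

lemma vector_field_lincomb:
  assumes "smooth_atlas A" "vector_field A X" "vector_field A Y"
  shows "vector_field A (\<lambda>p f. c * X p f + Y p f)"
  unfolding vector_field_def
proof (intro conjI allI impI)
  show "(\<lambda>f. c * X p f + Y p f) \<in> tangent_space A p" for p
    using assms(2,3) by (intro tangent_space_lincomb vector_field_tangent)
  show "smooth_fun A (\<lambda>p. c * X p f + Y p f)" if "smooth_fun A f" for f
    using smooth_fun_add[OF assms(1) smooth_fun_cmult[OF assms(1)
          smooth_fun_vector_field[OF assms(2) that]] smooth_fun_vector_field[OF assms(3) that]] .
qed

text \<open>The second-order operator X Y violates the Leibniz rule by the cross terms (X f)(Y h) +
  (Y f)(X h). These are symmetric in X and Y and cancel in the commutator.\<close>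

lemma vector_field_lie_bracket:
  assumes A: "smooth_atlas A" and X: "vector_field A X" and Y: "vector_field A Y"
  shows "vector_field A (lie_bracket X Y)"
  unfolding vector_field_def
proof (intro conjI allI impI)
  note sm = smooth_fun_vector_field[OF X] smooth_fun_vector_field[OF Y]
  show "smooth_fun A (\<lambda>p. lie_bracket X Y p f)" if "smooth_fun A f" for f
    unfolding lie_bracket_def by (intro smooth_fun_diff[OF A] sm that)
  fix p
  note XD = tangent_spaceD[OF vector_field_tangent[OF X]]
  note YD = tangent_spaceD[OF vector_field_tangent[OF Y]]
  show "lie_bracket X Y p \<in> tangent_space A p"
    unfolding tangent_space_def mem_Collect_eq
  proof (intro conjI allI impI)
    fix f h assume f: "smooth_fun A f" and h: "smooth_fun A h"
    note sf = sm(1)[OF f] sm(2)[OF f] and sh = sm(1)[OF h] sm(2)[OF h]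
    show "lie_bracket X Y p (\<lambda>q. f q + h q) = lie_bracket X Y p f + lie_bracket X Y p h"
      unfolding lie_bracket_def XD(1)[OF f h] YD(1)[OF f h] XD(1)[OF sf(2) sh(2)]
        YD(1)[OF sf(1) sh(1)] by simp
    have "X p (\<lambda>q. f q * Y q h + h q * Y q f)
        = f p * X p (\<lambda>q. Y q h) + Y p h * X p f + (h p * X p (\<lambda>q. Y q f) + Y p f * X p h)"
      unfolding XD(1)[OF smooth_fun_mult[OF A f sh(2)] smooth_fun_mult[OF A h sf(2)]]
        XD(3)[OF f sh(2)] XD(3)[OF h sf(2)] by simp
    moreover have "Y p (\<lambda>q. f q * X q h + h q * X q f)
        = f p * Y p (\<lambda>q. X q h) + X p h * Y p f + (h p * Y p (\<lambda>q. X q f) + X p f * Y p h)"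
      unfolding YD(1)[OF smooth_fun_mult[OF A f sh(1)] smooth_fun_mult[OF A h sf(1)]]
        YD(3)[OF f sh(1)] YD(3)[OF h sf(1)] by simp
    ultimately show
      "lie_bracket X Y p (\<lambda>q. f q * h q) = f p * lie_bracket X Y p h + h p * lie_bracket X Y p f"
      unfolding lie_bracket_def XD(3)[OF f h] YD(3)[OF f h] by (simp add: algebra_simps)
  next
    fix c f assume f: "smooth_fun A f"
    show "lie_bracket X Y p (\<lambda>q. c * f q) = c * lie_bracket X Y p f"
      unfolding lie_bracket_def XD(2)[OF f] YD(2)[OF f] XD(2)[OF sm(2)[OF f]] YD(2)[OF sm(1)[OF f]]
      by (simp add: algebra_simps)
  next
    fix f assume "\<not> smooth_fun A f"
    then have "(\<lambda>q. X q f) = (\<lambda>q. 0)" "(\<lambda>q. Y q f) = (\<lambda>q. 0)"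
      using tangent_spaceD(4)[OF vector_field_tangent[OF X]]
        tangent_spaceD(4)[OF vector_field_tangent[OF Y]] by auto
    \<comment> \<open>Homogeneity with scalar 0 shows that a tangent vector kills the zero
      function.\<close>
    moreover have "X p (\<lambda>q. 0) = 0" "Y p (\<lambda>q. 0) = 0"
      using XD(2)[OF smooth_fun_const[OF A], of p 0 0] YD(2)[OF smooth_fun_const[OF A], of p 0 0]
      by simp_all
    ultimately show "lie_bracket X Y p f = 0" by (simp add: lie_bracket_def)
  qed
qed

subsection \<open>The Lie derivative of the metric along an affine Killing field\<close>

locale riemannian =
  fixes A :: "('a::{t2_space, second_countable_topology}, 'n::finite) atlas"
    and g :: "'a metric_tensor" and N :: "'a connection"
  assumes atlas: "smooth_atlas A"
    and metric: "riemannian_metric A g"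
    and lc: "levi_civita A g N"
begin

abbreviation vf :: "'a vfield \<Rightarrow> bool" where "vf \<equiv> vector_field A"

abbreviation ip :: "'a vfield \<Rightarrow> 'a vfield \<Rightarrow> 'a \<Rightarrow> real" where
  "ip X Y p \<equiv> g p (X p) (Y p)"

lemma g_left: "u \<in> tangent_space A p \<Longrightarrow> v \<in> tangent_space A p \<Longrightarrow> w \<in> tangent_space A p \<Longrightarrow>
    g p (\<lambda>f. c * u f + v f) w = c * g p u w + g p v w"
  by (rule metric[unfolded riemannian_metric_def, THEN conjunct1, rule_format])

lemma g_commute: "u \<in> tangent_space A p \<Longrightarrow> v \<in> tangent_space A p \<Longrightarrow> g p u v = g p v u"
  by (rule metric[unfolded riemannian_metric_def, THEN conjunct2, THEN conjunct1, rule_format])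

lemma g_pos: "u \<in> tangent_space A p \<Longrightarrow> u \<noteq> (\<lambda>f. 0) \<Longrightarrow> 0 < g p u u"
  by (rule metric[unfolded riemannian_metric_def, THEN conjunct2, THEN conjunct2, THEN conjunct1,
        rule_format])

lemma ip_commute: "vf X \<Longrightarrow> vf Y \<Longrightarrow> ip X Y p = ip Y X p"
  by (intro g_commute vector_field_tangent)

lemma smooth_ip: "vf X \<Longrightarrow> vf Y \<Longrightarrow> smooth_fun A (ip X Y)"
  by (rule metric[unfolded riemannian_metric_def, THEN conjunct2, THEN conjunct2, THEN conjunct2,
        rule_format])

text \<open>The decomposition of \<open>W\<close> is required at \<open>p\<close> only. In this form
  the torsion and affine Killing identities are inserted into the metric; the second slot is reached
  through \<open>ip_commute\<close>.\<close>

lemma ip_add_left: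
  assumes "vf X" "vf Y" "vf Z" "\<And>f. W p f = X p f + Y p f"
  shows "ip W Z p = ip X Z p + ip Y Z p"
proof -
  have "W p = (\<lambda>f. 1 * X p f + Y p f)" using assms(4) by auto
  then have "ip W Z p = g p (\<lambda>f. 1 * X p f + Y p f) (Z p)" by (rule arg_cong)
  also have "\<dots> = 1 * ip X Z p + ip Y Z p"
    by (intro g_left vector_field_tangent assms)
  finally show ?thesis by simp
qed

lemma vf_N: "vf X \<Longrightarrow> vf Y \<Longrightarrow> vf (N X Y)"
  by (rule lc[unfolded levi_civita_def affine_connection_def, THEN conjunct1, THEN conjunct1,
        rule_format])

lemma vf_bracket: "vf X \<Longrightarrow> vf Y \<Longrightarrow> vf (lie_bracket X Y)"
  by (rule vector_field_lie_bracket[OF atlas])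

lemma torsion_free:
  assumes "vf X" "vf Y"
  shows "N X Y p f = lie_bracket X Y p f + N Y X p f"
proof -
  have "(\<lambda>p h. N X Y p h - N Y X p h) = lie_bracket X Y"
    by (rule lc[unfolded levi_civita_def, THEN conjunct2, THEN conjunct1, rule_format])
      (fact assms)+
  from fun_cong[OF fun_cong[OF this], of p f] show ?thesis by simp
qed

lemma metric_compatible:
  "vf X \<Longrightarrow> vf Y \<Longrightarrow> vf Z \<Longrightarrow> X p (ip Y Z) = ip (N X Y) Z p + ip Y (N X Z) p"
  by (rule lc[unfolded levi_civita_def, THEN conjunct2, THEN conjunct2, rule_format])

text \<open>Metric compatibility expands the derivative of g(X,Y) along V, and vanishing torsion
  turns \<open>N V X\<close> minus the bracket of V and X into \<open>N X V\<close>; likewise for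
  Y.\<close>

lemma lie_deriv_metric_eq:
  assumes V: "vf V" and X: "vf X" and Y: "vf Y"
  shows "lie_deriv_metric g V X Y p = ip (N X V) Y p + ip X (N Y V) p"
proof -
  have "ip (N V X) Y p = ip (lie_bracket V X) Y p + ip (N X V) Y p"
    by (rule ip_add_left) (simp_all add: torsion_free[OF V X] vf_bracket vf_N assms)
  moreover have "ip (N V Y) X p = ip (lie_bracket V Y) X p + ip (N Y V) X p"
    by (rule ip_add_left) (simp_all add: torsion_free[OF V Y] vf_bracket vf_N assms)
  then have "ip X (N V Y) p = ip X (lie_bracket V Y) p + ip X (N Y V) p"
    by (simp only: ip_commute[OF X] vf_bracket vf_N V Y)
  ultimately show ?thesis
    by (simp add: lie_deriv_metric_def metric_compatible[OF V X Y])
qed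

text \<open>Interchanging X and V in X(V(g(Y,Z))) costs a derivative along [V,X]. The affine Killing
  condition splits [V, N X Y] into a term with N along [V,X] and the term N X [V,Y], and likewise
  for Z. The terms along [V,X] cancel, and the rest is the Lie derivative of g on the covariantly
  differentiated arguments.\<close>

lemma lie_deriv_metric_parallel:
  assumes ak: "affine_killing A N V" and X: "vf X" and Y: "vf Y" and Z: "vf Z"
  shows "X p (lie_deriv_metric g V Y Z)
    = lie_deriv_metric g V (N X Y) Z p + lie_deriv_metric g V Y (N X Z) p"
proof -
  have V: "vf V" using ak by (simp add: affine_killing_def)
  note vf = V X Y Z vf_N vf_bracket
  note tan = vector_field_tangent
  have br: "lie_bracket V (N X Y) p f = N (lie_bracket V X) Y p f + N X (lie_bracket V Y) p f"
    if "vf Y" for Y f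
  proof -
    have "lie_deriv_connection N V X Y p f = 0"
      using ak X that by (simp add: affine_killing_def)
    then show ?thesis by (simp add: lie_deriv_connection_def)
  qed
  have "X p (lie_deriv_metric g V Y Z)
      = X p (\<lambda>q. V q (ip Y Z) - ip (lie_bracket V Y) Z q - ip Y (lie_bracket V Z) q)"
    by (simp add: lie_deriv_metric_def[abs_def])
  also have "\<dots> = X p (\<lambda>q. V q (ip Y Z)) - X p (ip (lie_bracket V Y) Z) - X p (ip Y (lie_bracket V Z))"
    by (simp add: tangent_space_diff[OF atlas tan[OF X]] smooth_fun_diff[OF atlas]
        smooth_fun_vector_field smooth_ip vf)
  finally have 1: "X p (lie_deriv_metric g V Y Z) = \<dots>" .
  have 2: "X p (\<lambda>q. V q (ip Y Z)) = V p (\<lambda>q. X q (ip Y Z)) - lie_bracket V X p (ip Y Z)"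
    by (simp add: lie_bracket_def)
  have 3: "V p (\<lambda>q. X q (ip Y Z)) = V p (ip (N X Y) Z) + V p (ip Y (N X Z))"
    by (simp add: metric_compatible tangent_spaceD(1)[OF tan[OF V]] smooth_ip vf)
  have 4: "lie_bracket V X p (ip Y Z) = ip (N (lie_bracket V X) Y) Z p + ip Y (N (lie_bracket V X) Z) p"
    by (simp add: metric_compatible vf)
  have 5: "ip (lie_bracket V (N X Y)) Z p = ip (N (lie_bracket V X) Y) Z p + ip (N X (lie_bracket V Y)) Z p"
    by (rule ip_add_left) (simp_all add: vf br)
  \<comment> \<open>The arguments are swapped because \<open>ip_add_left\<close> splits the first
    slot only.\<close>
  have "ip (lie_bracket V (N X Z)) Y p = ip (N (lie_bracket V X) Z) Y p + ip (N X (lie_bracket V Z)) Y p"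
    by (rule ip_add_left) (simp_all add: vf br)
  then have 6: "ip Y (lie_bracket V (N X Z)) p = ip Y (N (lie_bracket V X) Z) p + ip Y (N X (lie_bracket V Z)) p"
    by (simp only: ip_commute[OF Y] vf)
  show ?thesis
    unfolding 1 2 3 4
    by (simp add: lie_deriv_metric_def 5 6 metric_compatible vf)
qed

end

section \<open>Vanishing of modified conformal fields that are affine Killing\<close>

theorem theorem3p1:
  fixes A :: "('a::{t2_space, second_countable_topology}, 'n::finite) atlas"
    and g :: "'a metric_tensor"
    and N :: "'a connection"
    and V :: "'a vfield"
    and m :: real
  assumes "smooth_atlas A"
    and "2 \<le> CARD('n)"
    and "riemannian_metric A g"
    and "levi_civita A g N"
    and "0 < m"
    and "m_modified_conformal A g m V"
    and "affine_killing A N V"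
  shows "V = (\<lambda>p f. 0)"
proof -
  interpret riemannian A g N
    using assms by unfold_locales
  note tan = vector_field_tangent
  have V: "vf V" using assms(7) by (simp add: affine_killing_def)
  obtain \<sigma> where \<sigma>: "smooth_fun A \<sigma>"
    and conf: "\<And>X Y p. vf X \<Longrightarrow> vf Y \<Longrightarrow>
      lie_deriv_metric g V X Y p = 2 * (\<sigma> p * ip X Y p) + 2 / m * (ip V X p * ip V Y p)"
    using assms(6) unfolding m_modified_conformal_def flat_def by (fastforce simp: field_simps)
  have main: "X p \<sigma> * ip Y Z p + 1 / m * (ip (N X V) Y p * ip V Z p + ip V Y p * ip (N X V) Z p) = 0"
    if X: "vf X" and Y: "vf Y" and Z: "vf Z" for X Y Z p
  proof -
    note sm = smooth_ip[OF Y Z] smooth_ip[OF V Y] smooth_ip[OF V Z]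
    note XD = tangent_spaceD[OF tan[OF X]]
    have "X p (lie_deriv_metric g V Y Z)
        = X p (\<lambda>q. 2 * (\<sigma> q * ip Y Z q) + 2 / m * (ip V Y q * ip V Z q))"
      using conf[OF Y Z] by presburger
    also have "\<dots> = 2 * (\<sigma> p * X p (ip Y Z) + ip Y Z p * X p \<sigma>)
        + 2 / m * (ip V Y p * X p (ip V Z) + ip V Z p * X p (ip V Y))"
      by (simp add: XD \<sigma> sm smooth_fun_mult[OF atlas] smooth_fun_cmult[OF atlas] del: times_divide_eq_left)
    finally have "lie_deriv_metric g V (N X Y) Z p + lie_deriv_metric g V Y (N X Z) p = \<dots>"
      by (simp add: lie_deriv_metric_parallel[OF assms(7) X Y Z])
    \<comment> \<open>The left side is expanded by \<open>conf\<close>, the right side by metric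
      compatibility. All terms with \<open>N X Y\<close> or \<open>N X Z\<close> cancel, leaving the
      derivatives of \<sigma> and of V.\<close>
    then have "2 * (ip Y Z p * X p \<sigma>) + 2 / m * (ip (N X V) Y p * ip V Z p + ip V Y p * ip (N X V) Z p) = 0"
      by (simp add: conf metric_compatible vf_N X Y Z V algebra_simps add_divide_distrib)
    moreover have "a + 1 / m * b = 0" if "2 * a + 2 / m * b = 0" for a b
      using that \<open>0 < m\<close> by (simp add: divide_simps)
    ultimately show ?thesis by (simp add: mult.commute)
  qed
  have "V p = (\<lambda>f. 0)" for p
  proof (rule ccontr)
    assume "V p \<noteq> (\<lambda>f. 0)"
    then have VV: "ip V V p > 0" by (rule g_pos[OF tan[OF V]])
    obtain W where W: "vf W" and WV: "\<And>c. W p \<noteq> (\<lambda>f. c * V p f)"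
      using exists_vector_field_not_multiple[OF assms(1,2)] by metis
    \<comment> \<open>Gram-Schmidt coefficient at \<open>p\<close>. It is a constant, so
      \<open>Y\<close> is again a global field, orthogonal to V at \<open>p\<close> but not
      necessarily elsewhere.\<close>
    define c where "c = - ip V W p / ip V V p"
    define Y where "Y = (\<lambda>p f. c * V p f + W p f)"
    have Y: "vf Y"
      unfolding Y_def by (rule vector_field_lincomb[OF atlas V W])
    have "ip Y V p = c * ip V V p + ip W V p"
      unfolding Y_def by (intro g_left tan V W)
    also have "\<dots> = 0"
      using VV ip_commute[OF W V, of p] by (simp add: c_def)
    finally have "ip Y V p = 0" .
    then have VY: "ip V Y p = 0" by (simp add: ip_commute[OF V Y])
    have "Y p \<noteq> (\<lambda>f. 0)"
    proof
      assume "Y p = (\<lambda>f. 0)"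
      then have "c * V p f + W p f = 0" for f
        unfolding Y_def by meson
      then have "W p = (\<lambda>f. (- c) * V p f)" by (auto simp: add_eq_0_iff)
      then show False using WV by blast
    qed
    then have YY: "ip Y Y p > 0" by (rule g_pos[OF tan[OF Y]])
    have d\<sigma>: "X p \<sigma> = 0" if "vf X" for X
      using main[OF that Y Y, of p] YY by (simp add: VY)
    have NVV: "ip (N X V) V p = 0" if "vf X" for X
      using main[OF that V V, of p] VV \<open>0 < m\<close> by (simp add: d\<sigma>[OF that])
    \<comment> \<open>In \<open>main\<close> for the pair (V,Z), the first two terms vanish by
      \<open>d\<sigma>\<close> and \<open>NVV\<close>; the remaining one has the nonzero factor
      \<open>ip V V p\<close>.\<close>
    have NV: "ip (N X V) Z p = 0" if "vf X" "vf Z" for X Z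
      using main[OF that V, of p] VV \<open>0 < m\<close> by (simp add: d\<sigma> NVV that)
    have L: "lie_deriv_metric g V X X p = 0" if "vf X" for X
      using NV[OF that that] ip_commute[OF that vf_N[OF that V], of p]
      by (simp add: lie_deriv_metric_eq[OF V that that])
    \<comment> \<open>Since \<open>Y\<close> is orthogonal to V at \<open>p\<close>, the quadratic
      term of \<open>conf\<close> is absent and 0 = 2 \<sigma>(p) g(Y,Y) remains.\<close>
    have "\<sigma> p = 0"
      using conf[OF Y Y, of p] L[OF Y] YY by (simp add: VY)
    \<comment> \<open>With \<sigma>(p) = 0, \<open>conf\<close> on (V,V) reduces to 0 = (2/m)
      g(V,V)^2, contradicting \<open>VV\<close>.\<close>
    then show False
      using conf[OF V V, of p] L[OF V] VV \<open>0 < m\<close> by simp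
  qed
  then show ?thesis by auto
qed

end
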